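(* Let $d,n\ge 1$ be integers and let $f:[0,1]^d\to\mathbb{R}$ be a completely monotone function of the form $$f(\boldsymbol{x})=f(\boldsymbol{0})+\lambda\,\nu([\boldsymbol{0},\boldsymbol{x}])\qquad\text{for all }\boldsymbol{x}\in[0,1]^d,$$ where $\nu$ is a probability measure on the Borel $\sigma$-algebra of $[0,1]^d$ and $\lambda\ge 0$. Let $P_n=\{\boldsymbol{x}_0,\dots,\boldsymbol{x}_{n-1}\}\subset[0,1]^d$ and put $\widetilde P_n=\{\boldsymbol{1}-\boldsymbol{x}_0,\dots,\boldsymbol{1}-\boldsymbol{x}_{n-1}\}$. (i) If $\widetilde P_n$ has non-negative local discrepancy (NNLD), then $$\frac1n\sum_{i=0}^{n-1}f(\boldsymbol{x}_i)\ \ge\ \int_{[0,1]^d}f(\boldsymbol{x})\,\mathrm{d}\boldsymbol{x}.$$ (ii) If $P_n$ has non-positive local discrepancy (NPLD), and if additionally either $P_n\subset[0,1)^d\cup\{\boldsymbol{1}\}$ or $\nu$ is absolutely continuous with respect to Lebesgue measure, then $$\frac1n\sum_{i=0}^{n-1}f(\boldsymbol{1}-\boldsymbol{x}_i)\ \le\ \int_{[0,1]^d}f(\boldsymbol{x})\,\mathrm{d}\boldsymbol{x}.$$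
   Context: Vectors: $\boldsymbol{0}$ and $\boldsymbol{1}$ are the all-zeros and all-ones points of $[0,1]^d$. For $\boldsymbol{x},\boldsymbol{z}\in\mathbb{R}^d$, $\boldsymbol{x}\le\boldsymbol{z}$ means $x_j\le z_j$ for all $j$; $[\boldsymbol{0},\boldsymbol{z}]=\prod_{j=1}^d[0,z_j]$ and $[\boldsymbol{0},\boldsymbol{z})=\prod_{j=1}^d[0,z_j)$. Point sets are multisets (points counted with multiplicity), i.e. finite lists. The local discrepancy of a point set $Q_n$ with points $\boldsymbol{y}_0,\dots,\boldsymbol{y}_{n-1}\in[0,1]^d$ at $\boldsymbol{z}\in[0,1]^d$ is $$\delta(\boldsymbol{z};Q_n)=\frac1n\#\{0\le i<n:\boldsymbol{y}_i\in[\boldsymbol{0},\boldsymbol{z})\}-\prod_{j=1}^d z_j .$$ $Q_n$ has non-negative local discrepancy (NNLD) if $\delta(\boldsymbol{z};Q_n)\ge0$ for all $\boldsymbol{z}\in[0,1]^d$, and non-positive local discrepancy (NPLD) if $\delta(\boldsymbol{z};Q_n)\le0$ for all $\boldsymbol{z}\in[0,1]^d$. Complete monotonicity: for $v\subseteq\{1,\dots,d\}$ let $\boldsymbol{x}_{-v}{:}\boldsymbol{z}_v$ be the point with $j$-th component $z_j$ if $j\in v$ and $x_j$ if $j\notin v$. For $u\subseteq\{1,\dots,d\}$ put $\Delta_u(\boldsymbol{x},\boldsymbol{z})=\sum_{v\subseteq u}(-1)^{|u\setminus v|}f(\boldsymbol{x}_{-v}{:}\boldsymbol{z}_v)$. The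 function $f$ is completely monotone if $\Delta_u(\boldsymbol{x},\boldsymbol{z})\ge0$ for all non-empty $u$ and all $\boldsymbol{x},\boldsymbol{z}\in[0,1]^d$ with $x_j\le z_j$ for all $j\in u$. *)

theory Defs
  imports "HOL-Probability.Probability"
begin

text \<open>
  The unit cube is \<^term>\<open>{0..1} :: (real ^ 'd) set\<close> and the closed box spanned by the origin
  and \<open>x\<close> is \<open>{0..x}\<close>, both for the componentwise order on \<^typ>\<open>real ^ 'd\<close>.
  The half-open box is not \<open>{0..<z}\<close>: strict inequality on vectors only means
  \<open>y \<le> z \<and> y \<noteq> z\<close>.
\<close>

definition half_open_box :: "real ^ 'd \<Rightarrow> (real ^ 'd) set" where
  "half_open_box z = {y. \<forall>j. 0 \<le> y $ j \<and> y $ j < z $ j}"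

text \<open>Point sets are lists, so that points are counted with multiplicity.\<close>

definition local_discrepancy :: "real ^ 'd \<Rightarrow> (real ^ 'd) list \<Rightarrow> real" where
  "local_discrepancy z Q =
     real (card {i. i < length Q \<and> Q ! i \<in> half_open_box z}) / real (length Q)
       - (\<Prod>j\<in>UNIV. z $ j)"

definition NNLD :: "(real ^ 'd) list \<Rightarrow> bool" where
  "NNLD Q \<longleftrightarrow> (\<forall>z\<in>{0..1}. local_discrepancy z Q \<ge> 0)"

definition NPLD :: "(real ^ 'd) list \<Rightarrow> bool" where
  "NPLD Q \<longleftrightarrow> (\<forall>z\<in>{0..1}. local_discrepancy z Q \<le> 0)"

definition glue :: "'d set \<Rightarrow> real ^ 'd \<Rightarrow> real ^ 'd \<Rightarrow> real ^ 'd" where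
  "glue v x z = (\<chi> j. if j \<in> v then z $ j else x $ j)"

definition box_difference ::
    "(real ^ 'd \<Rightarrow> real) \<Rightarrow> 'd set \<Rightarrow> real ^ 'd \<Rightarrow> real ^ 'd \<Rightarrow> real" where
  "box_difference f u x z = (\<Sum>v\<in>Pow u. (- 1) ^ card (u - v) * f (glue v x z))"

text \<open>Only the values of \<open>f\<close> on the unit cube enter.\<close>

definition completely_monotone :: "(real ^ 'd \<Rightarrow> real) \<Rightarrow> bool" where
  "completely_monotone f \<longleftrightarrow>
     (\<forall>u x z. u \<noteq> {} \<and> x \<in> {0..1} \<and> z \<in> {0..1} \<and> (\<forall>j\<in>u. x $ j \<le> z $ j)
        \<longrightarrow> box_difference f u x z \<ge> 0)"

end

theory Submission
  imports Defs
begin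

text \<open>
  Writing \<open>\<nu>([0, x]) = \<integral> 1[y \<le> x] d\<nu>(y)\<close>, Fubini turns the integral of \<open>f\<close> into
  \<open>f(0) + \<lambda> \<integral> \<Prod>\<^sub>j (1 - y\<^sub>j) d\<nu>(y)\<close>, while the average of \<open>f\<close> over points \<open>q\<^sub>i\<close> becomes
  \<open>f(0) + \<lambda> \<integral> #{i. y \<le> q\<^sub>i} / n d\<nu>(y)\<close>. The two integrands are compared through the local
  discrepancy of the points \<open>1 - q\<^sub>i\<close> at \<open>z = 1 - y\<close>. The count uses \<open>\<le>\<close> where the local
  discrepancy uses \<open><\<close>. This helps in (i); in (ii) it is repaired by approximating \<open>z\<close> from above,
  or by noting that the two counts differ only for \<open>y\<close> on finitely many hyperplanes.
\<close>

section \<open>Volumes in the cube and the integral of \<open>\<nu>([0, x])\<close> over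
  \<open>x\<close>\<close>

lemma measure_upper_orthant_unit_cube:
  fixes y :: "real ^ 'd"
  assumes "y \<in> {0..1}"
  shows "measure lborel {y..1} = (\<Prod>j\<in>UNIV. 1 - y $ j)"
proof -
  have "{y..1} = cbox y 1" by (simp add: interval_cbox)
  moreover have "cbox y 1 \<noteq> {}"
    using assms by (auto simp: interval_cbox[symmetric])
  ultimately show ?thesis
    by (simp add: content_cbox_cart)
qed

text \<open>Pairing this space with \<open>\<nu>\<close> gives a product probability space, on which
  every bounded measurable function is integrable.\<close>

lemma prob_space_lborel_unit_cube:
  "prob_space (restrict_space lborel ({0..1} :: (real ^ 'd) set))"
proof
  have "{0..1} = cbox 0 (1 :: real ^ 'd)" by (simp add: interval_cbox)
  moreover have "measure lborel ({0..1} :: (real ^ 'd) set) = 1"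
    by (subst measure_upper_orthant_unit_cube) (auto simp: less_eq_vec_def)
  ultimately have "emeasure lborel ({0..1} :: (real ^ 'd) set) = 1"
    using emeasure_eq_ennreal_measure[of lborel "{0..1} :: (real ^ 'd) set"]
      emeasure_lborel_cbox_finite[of 0 "1 :: real ^ 'd"] by simp
  then show "emeasure (restrict_space lborel {0..1})
      (space (restrict_space lborel ({0..1} :: (real ^ 'd) set))) = 1"
    by (simp add: emeasure_restrict_space space_restrict_space)
qed

text \<open>Both sides are iterated integrals of the indicator of \<open>y \<le> x\<close>:
  integrating out \<open>y\<close> first leaves \<open>\<nu>([0, x])\<close>, integrating out
  \<open>x\<close> first leaves the volume of \<open>[y, 1]\<close>. Fubini also yields the
  integrability of the inner integral.\<close>

lemma integral_measure_lower_orthant: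
  fixes \<nu> :: "(real ^ 'd) measure"
  assumes "prob_space \<nu>" and sets: "sets \<nu> = sets (restrict_space borel {0..1})"
  shows "(LINT x:{0..1}|lborel. measure \<nu> {0..x}) = (LINT y|\<nu>. (\<Prod>j\<in>UNIV. 1 - y $ j))"
    and "set_integrable lborel {0..1} (\<lambda>x. measure \<nu> {0..x})"
proof -
  define U :: "(real ^ 'd) measure" where "U = restrict_space lborel {0..1}"
  interpret N: prob_space \<nu> by fact
  interpret U: prob_space U unfolding U_def by (rule prob_space_lborel_unit_cube)
  interpret UN: pair_prob_space U \<nu> ..
  have space: "space \<nu> = {0..1}" "space U = {0..1}"
    using sets_eq_imp_space_eq[OF sets] by (auto simp: space_restrict_space U_def)
  \<comment> \<open>Both measures live on the trace sigma-algebra of the cube; composing with the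
    inclusion into the whole space makes the coordinates measurable.\<close>
  have id: "(\<lambda>x. x) \<in> borel_measurable \<nu>" "(\<lambda>x. x) \<in> borel_measurable U"
    unfolding measurable_cong_sets[OF sets refl]
    by (auto simp: U_def intro: measurable_restrict_space1)
  have nth: "(\<lambda>x :: real ^ 'd. x $ j) \<in> borel_measurable borel" for j
    by (intro borel_measurable_continuous_onI continuous_intros)
  have [measurable]: "(\<lambda>p. fst p $ j) \<in> borel_measurable (U \<Otimes>\<^sub>M \<nu>)"
      "(\<lambda>p. snd p $ j) \<in> borel_measurable (U \<Otimes>\<^sub>M \<nu>)" for j
    by (rule measurable_compose[OF measurable_compose[OF measurable_fst id(2)] nth]
        measurable_compose[OF measurable_compose[OF measurable_snd id(1)] nth])+
  define h :: "real ^ 'd \<Rightarrow> real ^ 'd \<Rightarrow> real" where "h x y = (if y \<le> x then 1 else 0)" for x y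
  \<comment> \<open>The vector order is a finite conjunction of coordinate inequalities, hence
    jointly measurable.\<close>
  have "Measurable.pred (U \<Otimes>\<^sub>M \<nu>) (\<lambda>p. snd p \<le> fst p)"
    unfolding less_eq_vec_def by measurable
  then have "case_prod h \<in> borel_measurable (U \<Otimes>\<^sub>M \<nu>)"
    unfolding h_def case_prod_beta by measurable
  then have int: "integrable (U \<Otimes>\<^sub>M \<nu>) (case_prod h)"
    by (intro UN.integrable_const_bound[where B = 1]) (auto simp: h_def)
  have 1: "(LINT y|\<nu>. h x y) = measure \<nu> {0..x}" if "x \<in> {0..1}" for x
  proof -
    have "{0..x} \<in> sets \<nu>" using that unfolding sets
      by (subst sets_restrict_space_iff) auto
    moreover have "(LINT y|\<nu>. h x y) = (LINT y|\<nu>. indicator {0..x} y)"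
      by (rule Bochner_Integration.integral_cong) (auto simp: h_def space)
    ultimately show ?thesis using sets.sets_into_space by (simp add: Int_absorb2)
  qed
  have 2: "(LINT x|U. h x y) = (\<Prod>j\<in>UNIV. 1 - y $ j)" if "y \<in> {0..1}" for y
  proof -
    \<comment> \<open>Since \<open>0 \<le> y\<close>, the box \<open>[y, 1]\<close> lies inside the
      cube, and cutting \<open>y \<le> x\<close> down to the cube gives exactly this box.\<close>
    have "indicator {0..1} x *\<^sub>R h x y = indicator {y..1} x" for x
      using that by (auto simp: h_def indicator_def)
    then have "(LINT x|U. h x y) = (LINT x|lborel. indicator {y..1} x)"
      by (simp add: U_def integral_restrict_space set_lebesgue_integral_def)
    then show ?thesis using measure_upper_orthant_unit_cube[OF that] by simp
  qed
  have "(LINT x:{0..1}|lborel. measure \<nu> {0..x}) = (LINT x|U. measure \<nu> {0..x})"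
    by (simp add: U_def integral_restrict_space set_lebesgue_integral_def)
  also have "\<dots> = (LINT x|U. LINT y|\<nu>. h x y)"
    by (rule Bochner_Integration.integral_cong) (auto simp: 1 space)
  also have "\<dots> = (LINT y|\<nu>. LINT x|U. h x y)"
    using UN.Fubini_integral[OF int] by simp
  also have "\<dots> = (LINT y|\<nu>. (\<Prod>j\<in>UNIV. 1 - y $ j))"
    by (rule Bochner_Integration.integral_cong) (auto simp: 2 space)
  finally show "(LINT x:{0..1}|lborel. measure \<nu> {0..x}) = (LINT y|\<nu>. (\<Prod>j\<in>UNIV. 1 - y $ j))" .
  have "integrable U (\<lambda>x. LINT y|\<nu>. h x y)"
    using UN.integrable_fst'[OF int] by simp
  then have "integrable U (\<lambda>x. measure \<nu> {0..x})"
    by (rule Bochner_Integration.integrable_cong[THEN iffD1, rotated 2]) (auto simp: 1 space)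
  then show "set_integrable lborel {0..1} (\<lambda>x. measure \<nu> {0..x})"
    by (simp add: U_def integrable_restrict_space set_integrable_def)
qed

section \<open>Averages of \<open>\<nu>([0, q])\<close> over a point set\<close>

definition dominating_fraction :: "(real ^ 'd) list \<Rightarrow> real ^ 'd \<Rightarrow> real" where
  "dominating_fraction Q y = real (card {i. i < length Q \<and> y \<le> Q ! i}) / real (length Q)"

text \<open>The measure of a box is the integral of its indicator, and a finite sum commutes with
  the integral. For empty \<open>Q\<close> both sides are 0, as division by zero gives 0.\<close>

lemma average_measure_lower_orthant:
  fixes \<nu> :: "(real ^ 'd) measure"
  assumes "prob_space \<nu>" and sets: "sets \<nu> = sets (restrict_space borel {0..1})"
    and Q: "set Q \<subseteq> {0..1}"
  shows "1 / real (length Q) * (\<Sum>i<length Q. measure \<nu> {0..Q ! i})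
           = (LINT y|\<nu>. dominating_fraction Q y)"
    and "integrable \<nu> (dominating_fraction Q)"
proof -
  interpret prob_space \<nu> by fact
  have space: "space \<nu> = {0..1}"
    using sets_eq_imp_space_eq[OF sets] by (simp add: space_restrict_space)
  have S: "{0..Q ! i} \<in> sets \<nu>" if "i < length Q" for i
  proof -
    have "Q ! i \<in> {0..1}" using that Q nth_mem by blast
    then show ?thesis unfolding sets by (subst sets_restrict_space_iff) auto
  qed
  \<comment> \<open>\<open>g\<close> agrees with \<open>dominating_fraction Q\<close> only on the
    cube, where \<open>0 \<le> y\<close> is automatic.\<close>
  define g where "g y = 1 / real (length Q) * (\<Sum>i<length Q. indicator {0..Q ! i} y :: real)" for y
  have eq: "dominating_fraction Q y = g y" if "y \<in> space \<nu>" for y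
  proof -
    have "(\<Sum>i<length Q. indicator {0..Q ! i} y :: real)
        = (\<Sum>i<length Q. if y \<le> Q ! i then 1 else 0)"
      using that by (intro sum.cong) (auto simp: space indicator_def)
    also have "\<dots> = real (card ({..<length Q} \<inter> {i. y \<le> Q ! i}))"
      by (simp add: sum.If_cases)
    also have "{..<length Q} \<inter> {i. y \<le> Q ! i} = {i. i < length Q \<and> y \<le> Q ! i}" by auto
    finally show ?thesis by (simp add: dominating_fraction_def g_def)
  qed
  have int: "integrable \<nu> (indicator {0..Q ! i} :: _ \<Rightarrow> real)" if "i < length Q" for i
    using S[OF that] by (simp add: integrable_indicator_iff emeasure_finite less_top[symmetric])
  have "integrable \<nu> g"
    unfolding g_def by (intro integrable_mult_right Bochner_Integration.integrable_sum int) simp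
  then show "integrable \<nu> (dominating_fraction Q)"
    by (rule Bochner_Integration.integrable_cong[THEN iffD1, rotated 2]) (auto simp: eq)
  have "(LINT y|\<nu>. dominating_fraction Q y) = (LINT y|\<nu>. g y)"
    by (rule Bochner_Integration.integral_cong) (auto simp: eq)
  also have "\<dots> = 1 / real (length Q) * (\<Sum>i<length Q. LINT y|\<nu>. indicator {0..Q ! i} y)"
    unfolding g_def
    by (subst integral_mult_right_zero, subst Bochner_Integration.integral_sum) (auto intro: int)
  also have "(\<Sum>i<length Q. LINT y|\<nu>. indicator {0..Q ! i} y) = (\<Sum>i<length Q. measure \<nu> {0..Q ! i})"
    using sets.sets_into_space[OF S] by (intro sum.cong) (auto simp: Int_absorb2)
  finally show "1 / real (length Q) * (\<Sum>i<length Q. measure \<nu> {0..Q ! i})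
           = (LINT y|\<nu>. dominating_fraction Q y)" by simp
qed

lemma integrable_prod_one_minus:
  fixes \<nu> :: "(real ^ 'd) measure"
  assumes "prob_space \<nu>" and sets: "sets \<nu> = sets (restrict_space borel {0..1})"
  shows "integrable \<nu> (\<lambda>y. \<Prod>j\<in>UNIV. 1 - y $ j)"
proof -
  interpret prob_space \<nu> by fact
  have space: "space \<nu> = {0..1}"
    using sets_eq_imp_space_eq[OF sets] by (simp add: space_restrict_space)
  have "(\<lambda>y :: real ^ 'd. \<Prod>j\<in>UNIV. 1 - y $ j) \<in> borel_measurable borel"
    by (intro borel_measurable_continuous_onI continuous_intros)
  then have "(\<lambda>y. \<Prod>j\<in>UNIV. 1 - y $ j) \<in> borel_measurable \<nu>"
    unfolding measurable_cong_sets[OF sets refl] by (rule measurable_restrict_space1)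
  moreover have "norm (\<Prod>j\<in>UNIV. 1 - y $ j) \<le> 1" if "y \<in> space \<nu>" for y
    using that unfolding space
    by (auto simp: abs_prod less_eq_vec_def abs_le_iff intro!: prod_le_1)
  ultimately show ?thesis by (intro integrable_const_bound[where B = 1]) auto
qed

section \<open>Comparison of the integrands under the two discrepancy conditions\<close>

lemma dominating_fraction_ge:
  fixes P :: "(real ^ 'd) list"
  assumes "NNLD (map (\<lambda>x. 1 - x) P)" and P: "set P \<subseteq> {0..1}" and y: "y \<in> {0..1}"
  shows "(\<Prod>j\<in>UNIV. 1 - y $ j) \<le> dominating_fraction P y"
proof -
  let ?A = "{i. i < length P \<and> map (\<lambda>x. 1 - x) P ! i \<in> half_open_box (1 - y)}"
  have "1 - y \<in> {0..1}" using y by (auto simp: less_eq_vec_def)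
  then have "(\<Prod>j\<in>UNIV. 1 - y $ j) \<le> real (card ?A) / real (length P)"
    using assms(1)[unfolded NNLD_def local_discrepancy_def, THEN bspec, of "1 - y"]
    by (simp del: nth_map)
  \<comment> \<open>The strict inequality \<open>1 - x $ j < 1 - y $ j\<close> weakens to
    \<open>y $ j \<le> x $ j\<close>, so the closed count can only be larger.\<close>
  also have "?A \<subseteq> {i. i < length P \<and> y \<le> P ! i}"
    by (auto simp: half_open_box_def less_eq_vec_def intro: less_imp_le)
  then have "real (card ?A) / real (length P) \<le> dominating_fraction P y"
    unfolding dominating_fraction_def by (intro divide_right_mono of_nat_mono card_mono) auto
  finally show ?thesis .
qed

text \<open>Moving the reflection to the other side of the inequality brings in the points of
  \<open>P\<close> themselves, to which \<open>NPLD P\<close> refers.\<close>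

lemma dominating_fraction_reflect:
  "dominating_fraction (map (\<lambda>x. 1 - x) P) y
     = real (card {i. i < length P \<and> P ! i \<le> 1 - y}) / real (length P)"
proof -
  have "{i. i < length P \<and> y \<le> map (\<lambda>x. 1 - x) P ! i} = {i. i < length P \<and> P ! i \<le> 1 - y}"
    by (auto simp: le_diff_eq add.commute)
  then show ?thesis by (simp add: dominating_fraction_def)
qed

text \<open>\<open>A\<close> is left free so that a closed count can be bounded once it fits into
  some half-open box.\<close>

lemma NPLD_half_open:
  fixes P :: "(real ^ 'd) list"
  assumes "NPLD P" and "z \<in> {0..1}"
    and "A \<subseteq> {i. i < length P \<and> P ! i \<in> half_open_box z}"
  shows "real (card A) / real (length P) \<le> (\<Prod>j\<in>UNIV. z $ j)"
proof -
  have "real (card A) / real (length P)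
      \<le> real (card {i. i < length P \<and> P ! i \<in> half_open_box z}) / real (length P)"
    using assms(3) by (intro divide_right_mono of_nat_mono card_mono) auto
  also have "\<dots> \<le> (\<Prod>j\<in>UNIV. z $ j)"
    using assms(1,2) unfolding NPLD_def local_discrepancy_def by force
  finally show ?thesis .
qed

text \<open>The closed box \<open>[0, z]\<close> is enlarged to half-open boxes with corners
  slightly above \<open>z\<close>, capped at 1. The cap could lose only points with a coordinate
  equal to 1; by the hypothesis on \<open>P\<close> the only such point is \<open>1\<close>, which
  is not below \<open>z\<close> unless \<open>z = 1\<close>.\<close>

lemma NPLD_closed:
  fixes P :: "(real ^ 'd) list"
  assumes npld: "NPLD P" and P: "set P \<subseteq> half_open_box 1 \<union> {1}" and z: "z \<in> {0..1}"
  shows "real (card {i. i < length P \<and> P ! i \<le> z}) / real (length P) \<le> (\<Prod>j\<in>UNIV. z $ j)"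
proof (cases "z = 1")
  case True
  \<comment> \<open>At the corner the product is 1, and a fraction of the points never exceeds
    1.\<close>
  have "card {i. i < length P \<and> P ! i \<le> z} \<le> card {..<length P}"
    by (rule card_mono) auto
  then show ?thesis using True by (simp add: divide_le_eq_1)
next
  case False
  let ?A = "{i. i < length P \<and> P ! i \<le> z}"
  \<comment> \<open>The cap keeps the enlarged corner in the cube, where \<open>NPLD\<close> can be
    applied.\<close>
  let ?w = "\<lambda>\<epsilon>. \<chi> j. min 1 (z $ j + \<epsilon>)"
  have z': "0 \<le> z $ j" "z $ j \<le> 1" for j using z by (auto simp: less_eq_vec_def)
  have le: "real (card ?A) / real (length P) \<le> (\<Prod>j\<in>UNIV. min 1 (z $ j + \<epsilon>))"
    if "\<epsilon> > 0" for \<epsilon>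
  proof -
    have "?w \<epsilon> \<in> {0..1}" using that z' by (auto simp: less_eq_vec_def add_nonneg_nonneg)
    moreover have "?A \<subseteq> {i. i < length P \<and> P ! i \<in> half_open_box (?w \<epsilon>)}"
    proof safe
      fix i assume i: "i < length P" and le: "P ! i \<le> z"
      have "P ! i \<noteq> 1"
      proof
        assume "P ! i = 1"
        then have "z = 1" using le z by auto
        then show False using False by contradiction
      qed
      then have "P ! i \<in> half_open_box 1" using P i nth_mem by blast
      moreover have "P ! i $ j < z $ j + \<epsilon>" for j
        using le \<open>\<epsilon> > 0\<close> by (auto simp: less_eq_vec_def intro: le_less_trans)
      ultimately show "P ! i \<in> half_open_box (?w \<epsilon>)"
        by (auto simp: half_open_box_def)
    qed
    ultimately show ?thesis using NPLD_half_open[OF npld, of "?w \<epsilon>" ?A] by simp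
  qed
  \<comment> \<open>The bound survives \<open>\<epsilon>\<close> tending to 0 from the right; in the
    limit the cap has no effect because \<open>z \<le> 1\<close>.\<close>
  have "((\<lambda>\<epsilon>. \<Prod>j\<in>UNIV. min 1 (z $ j + \<epsilon>)) \<longlongrightarrow> (\<Prod>j\<in>UNIV. min 1 (z $ j + 0))) (at_right 0)"
    by (intro tendsto_intros)
  moreover have "eventually (\<lambda>\<epsilon>. real (card ?A) / real (length P)
      \<le> (\<Prod>j\<in>UNIV. min 1 (z $ j + \<epsilon>))) (at_right 0)"
    using le by (auto simp: eventually_at_right_less intro: eventually_mono[OF eventually_at_right_less])
  ultimately have "real (card ?A) / real (length P) \<le> (\<Prod>j\<in>UNIV. min 1 (z $ j + 0))"
    by (intro tendsto_lowerbound) auto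
  then show ?thesis using z' by (simp add: min_absorb2)
qed

text \<open>The exceptional \<open>y\<close> lie on finitely many axis-parallel hyperplanes, which
  are Lebesgue null and therefore \<open>\<nu>\<close>-null.\<close>

lemma AE_no_shared_coordinate:
  fixes \<nu> :: "(real ^ 'd) measure"
  assumes ac: "absolutely_continuous (restrict_space lborel {0..1}) \<nu>"
    and space: "space \<nu> = {0..1}" and "finite X"
  shows "AE y in \<nu>. \<forall>x\<in>X. \<forall>j. y $ j \<noteq> x $ j"
proof -
  have "AE y in \<nu>. y $ j \<noteq> a" for j a
  proof (rule AE_I')
    \<comment> \<open>Absolute continuity is relative to Lebesgue measure on the cube, so the
      hyperplane is first cut down to the cube.\<close>
    let ?H = "{y \<in> {0..1}. y $ j = a}"
    have "negligible {y :: real ^ 'd. y $ j = a}"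
      using negligible_standard_hyperplane[of "axis j 1 :: real ^ 'd" a]
      by (simp add: inner_axis axis_in_Basis_iff)
    moreover have "{y :: real ^ 'd. y $ j = a} \<in> sets borel"
      by (intro borel_closed closed_Collect_eq continuous_intros)
    ultimately have "{y :: real ^ 'd. y $ j = a} \<in> null_sets lborel"
      by (auto simp: negligible_iff_null_sets null_sets_def)
    then have "{y :: real ^ 'd. y $ j = a} \<inter> {0..1} \<in> null_sets lborel"
      by (rule null_set_Int2) auto
    then have "?H \<in> null_sets lborel"
      by (rule back_subst[where P = "\<lambda>A. A \<in> null_sets lborel"]) auto
    then have "?H \<in> null_sets (restrict_space lborel {0..1})"
      by (subst null_sets_restrict_space) auto
    then show "?H \<in> null_sets \<nu>" using ac by (auto simp: absolutely_continuous_def)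
    show "{y \<in> space \<nu>. \<not> y $ j \<noteq> a} \<subseteq> ?H" by (auto simp: space)
  qed
  then have "AE y in \<nu>. \<forall>j\<in>UNIV. y $ j \<noteq> x $ j" for x
    by (intro AE_finite_allI) auto
  then show ?thesis using \<open>finite X\<close> by (intro AE_finite_allI) auto
qed

text \<open>Under the condition on \<open>P\<close> the inequality holds at every \<open>y\<close>
  in the cube. Under absolute continuity it is shown away from ties
  \<open>x $ j = 1 - y $ j\<close>, where \<open>\<le>\<close> and \<open><\<close> agree; ties form
  a null set.\<close>

lemma AE_dominating_fraction_reflect_le:
  fixes P :: "(real ^ 'd) list"
  assumes npld: "NPLD P" and P: "set P \<subseteq> {0..1}" and space: "space \<nu> = {0..1}"
    and "set P \<subseteq> half_open_box 1 \<union> {1} \<or>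
         absolutely_continuous (restrict_space lborel {0..1}) \<nu>"
  shows "AE y in \<nu>. dominating_fraction (map (\<lambda>x. 1 - x) P) y \<le> (\<Prod>j\<in>UNIV. 1 - y $ j)"
  using assms(4)
proof
  assume *: "set P \<subseteq> half_open_box 1 \<union> {1}"
  have "dominating_fraction (map (\<lambda>x. 1 - x) P) y \<le> (\<Prod>j\<in>UNIV. 1 - y $ j)"
    if "y \<in> space \<nu>" for y
  proof -
    have "1 - y \<in> {0..1}" using that by (auto simp: space less_eq_vec_def)
    then show ?thesis unfolding dominating_fraction_reflect
      using NPLD_closed[OF npld *, of "1 - y"] by simp
  qed
  then show ?thesis by auto
next
  assume "absolutely_continuous (restrict_space lborel {0..1}) \<nu>"
  then have "AE y in \<nu>. \<forall>x\<in>(\<lambda>x. 1 - x) ` set P. \<forall>j. y $ j \<noteq> x $ j"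
    using space by (rule AE_no_shared_coordinate) simp
  then show ?thesis
  proof (rule AE_mp, intro AE_I2 impI)
    fix y assume "y \<in> space \<nu>" and ne: "\<forall>x\<in>(\<lambda>x. 1 - x) ` set P. \<forall>j. y $ j \<noteq> x $ j"
    then have "1 - y \<in> {0..1}" by (auto simp: space less_eq_vec_def)
    moreover have "{i. i < length P \<and> P ! i \<le> 1 - y}
        \<subseteq> {i. i < length P \<and> P ! i \<in> half_open_box (1 - y)}"
    proof safe
      fix i assume i: "i < length P" and le: "P ! i \<le> 1 - y"
      have "P ! i \<in> set P" using i by simp
      then have "0 \<le> P ! i" and ne': "y $ j \<noteq> 1 - P ! i $ j" for j using P ne by force+
      moreover have "P ! i $ j < 1 - y $ j" for j
      proof -
        have "P ! i $ j \<le> 1 - y $ j" using le by (simp add: less_eq_vec_def)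
        then show ?thesis using ne'[of j] by simp
      qed
      ultimately show "P ! i \<in> half_open_box (1 - y)"
        by (simp add: half_open_box_def less_eq_vec_def)
    qed
    ultimately show "dominating_fraction (map (\<lambda>x. 1 - x) P) y \<le> (\<Prod>j\<in>UNIV. 1 - y $ j)"
      unfolding dominating_fraction_reflect
      using NPLD_half_open[OF npld, of "1 - y"] by simp
  qed
qed

theorem theorem1:
  fixes f :: "real ^ 'd \<Rightarrow> real"
    and \<nu> :: "(real ^ 'd) measure"
    and c :: real
    and n :: nat
    and P :: "(real ^ 'd) list"
  assumes "n \<ge> 1"
    and "completely_monotone f"
    and "prob_space \<nu>"
    and "sets \<nu> = sets (restrict_space borel {0..1})"
    and "c \<ge> 0"
    and "\<And>x. x \<in> {0..1} \<Longrightarrow> f x = f 0 + c * measure \<nu> {0..x}"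
    and "length P = n"
    and "set P \<subseteq> {0..1}"
  shows "(NNLD (map (\<lambda>x. 1 - x) P) \<longrightarrow>
            (1 / real n) * (\<Sum>i<n. f (P ! i)) \<ge> (LINT x:{0..1}|lborel. f x))
       \<and> (NPLD P \<and>
            (set P \<subseteq> half_open_box 1 \<union> {1} \<or>
             absolutely_continuous (restrict_space lborel {0..1}) \<nu>) \<longrightarrow>
            (1 / real n) * (\<Sum>i<n. f (1 - P ! i)) \<le> (LINT x:{0..1}|lborel. f x))"
proof -
  note \<nu> = assms(3,4)
  have space: "space \<nu> = {0..1}"
    using sets_eq_imp_space_eq[OF assms(4)] by (simp add: space_restrict_space)
  let ?P' = "map (\<lambda>x. 1 - x) P"
  let ?g = "\<lambda>y :: real ^ 'd. \<Prod>j\<in>UNIV. 1 - y $ j"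
  have P': "set ?P' \<subseteq> {0..1}" using assms(8) by (force simp: less_eq_vec_def)
  \<comment> \<open>Stated for arbitrary \<open>Q\<close> to serve both \<open>P\<close> and its
    reflection. \<open>n \<ge> 1\<close> is what makes the constants \<open>f 0\<close> average to
    \<open>f 0\<close>.\<close>
  have average: "1 / real n * (\<Sum>i<n. f (Q ! i)) = f 0 + c * (LINT y|\<nu>. dominating_fraction Q y)"
    if "length Q = n" "set Q \<subseteq> {0..1}" for Q
  proof -
    have "(\<Sum>i<n. f (Q ! i)) = (\<Sum>i<n. f 0 + c * measure \<nu> {0..Q ! i})"
      using that nth_mem by (intro sum.cong refl assms(6)) blast
    also have "\<dots> = n * f 0 + c * (\<Sum>i<n. measure \<nu> {0..Q ! i})"
      by (simp add: sum.distrib sum_distrib_left)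
    finally show ?thesis
      using \<open>n \<ge> 1\<close> average_measure_lower_orthant(1)[OF \<nu> that(2)] that(1)
      by (simp add: field_simps)
  qed
  have "measure lborel ({0..1} :: (real ^ 'd) set) = 1"
    by (subst measure_upper_orthant_unit_cube) (auto simp: less_eq_vec_def)
  then have cube: "(LINT x:({0..1} :: (real ^ 'd) set)|lborel. f 0) = f 0"
    by (simp add: set_lebesgue_integral_def)
  have const: "set_integrable lborel ({0..1} :: (real ^ 'd) set) (\<lambda>_. f 0)"
    by (simp add: interval_cbox set_integrable_def integrable_indicator_iff
        emeasure_lborel_cbox_finite[unfolded infinity_ennreal_def])
  have "(LINT x:{0..1}|lborel. f x) = (LINT x:{0..1}|lborel. f 0 + c * measure \<nu> {0..x})"
    by (rule set_lebesgue_integral_cong) (auto intro: assms(6))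
  also have "\<dots> = (LINT x:({0..1} :: (real ^ 'd) set)|lborel. f 0)
      + c * (LINT x:{0..1}|lborel. measure \<nu> {0..x})"
    using const integral_measure_lower_orthant(2)[OF \<nu>] by (subst set_integral_add) auto
  finally have integral: "(LINT x:{0..1}|lborel. f x) = f 0 + c * (LINT y|\<nu>. ?g y)"
    by (simp add: integral_measure_lower_orthant(1)[OF \<nu>] cube)
  \<comment> \<open>Averages and integral now share the form \<open>f 0 + c * _\<close>, so by
    \<open>c \<ge> 0\<close> only the \<open>\<nu>\<close>-integrals remain to be compared.\<close>
  have "(LINT y|\<nu>. ?g y) \<le> (LINT y|\<nu>. dominating_fraction P y)" if "NNLD ?P'"
    using dominating_fraction_ge[OF that assms(8)] space
    by (intro integral_mono integrable_prod_one_minus[OF \<nu>]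
        average_measure_lower_orthant(2)[OF \<nu> assms(8)]) auto
  moreover have "(LINT y|\<nu>. dominating_fraction ?P' y) \<le> (LINT y|\<nu>. ?g y)"
    if "NPLD P" "set P \<subseteq> half_open_box 1 \<union> {1} \<or>
             absolutely_continuous (restrict_space lborel {0..1}) \<nu>"
    using AE_dominating_fraction_reflect_le[OF that(1) assms(8) space that(2)]
    by (intro integral_mono_AE integrable_prod_one_minus[OF \<nu>]
        average_measure_lower_orthant(2)[OF \<nu> P'])
  moreover have "(\<Sum>i<n. f (1 - P ! i)) = (\<Sum>i<n. f (?P' ! i))"
    using assms(7) by simp
  ultimately show ?thesis
    using average[OF assms(7,8)] average[OF _ P'] assms(5,7)
    by (auto simp: integral intro!: mult_left_mono simp del: map_map)
qed

end
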